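(* Let $\alpha>3$, $\beta>0$, $t_0>0$, and let $\Phi:\mathcal H\to\mathbb R$ be a twice continuously differentiable convex function which is boundedly inf-compact and satisfies $\operatorname{argmin}\Phi\neq\emptyset$. Then every solution $x:[t_0,+\infty[\to\mathcal H$ of $$\ddot x(t)+\frac{\alpha}{t}\dot x(t)+\beta\nabla^2\Phi(x(t))\dot x(t)+\nabla\Phi(x(t))=0$$ converges strongly, as $t\to+\infty$, to some $x^*\in\operatorname{argmin}\Phi$.
   Context: $\mathcal H$ is a real Hilbert space. A function $\Phi:\mathcal H\to\mathbb R$ is boundedly inf-compact if, for every $\lambda\in\mathbb R$ and $R>0$, the set $\{x\in\mathcal H:\ \Phi(x)\le\lambda,\ \|x\|\le R\}$ is relatively compact in $\mathcal H$. A solution $x$ of the differential equation is a twice continuously differentiable function satisfying it for all $t\ge t_0$. *)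

theory Defs
  imports "HOL-Analysis.Analysis"
begin

text \<open>Twice continuously Frechet differentiable on the whole space; both derivatives are
  continuous linear maps, and the second one is continuous in the operator norm.\<close>

definition twice_continuously_differentiable ::
    "('a::real_normed_vector \<Rightarrow> 'b::real_normed_vector) \<Rightarrow> bool"
  where "twice_continuously_differentiable f \<longleftrightarrow>
    (\<exists>(f' :: 'a \<Rightarrow> 'a \<Rightarrow>\<^sub>L 'b) (f'' :: 'a \<Rightarrow> 'a \<Rightarrow>\<^sub>L 'a \<Rightarrow>\<^sub>L 'b).
      (\<forall>x. (f has_derivative blinfun_apply (f' x)) (at x)) \<and>
      (\<forall>x. (f' has_derivative blinfun_apply (f'' x)) (at x)) \<and>
      continuous_on UNIV f'')"

definition gradient :: "('a::real_inner \<Rightarrow> real) \<Rightarrow> 'a \<Rightarrow> 'a"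
  where "gradient f x = (THE g. GDERIV f x :> g)"

text \<open>The Hessian as an operator on the space: the Frechet derivative of the gradient map.\<close>

definition hessian :: "('a::real_inner \<Rightarrow> real) \<Rightarrow> 'a \<Rightarrow> 'a \<Rightarrow> 'a"
  where "hessian f x = frechet_derivative (gradient f) (at x)"

definition argmin :: "('a \<Rightarrow> real) \<Rightarrow> 'a set"
  where "argmin f = {z. is_arg_min f (\<lambda>_. True) z}"

definition boundedly_inf_compact :: "('a::real_normed_vector \<Rightarrow> real) \<Rightarrow> bool"
  where "boundedly_inf_compact f \<longleftrightarrow>
    (\<forall>(l::real) (R::real). R > 0 \<longrightarrow> compact (closure {x. f x \<le> l \<and> norm x \<le> R}))"

text \<open>Solutions are twice continuously differentiable on the closed half-line; derivatives are
  taken within \<open>{t0..}\<close>, hence one-sided at \<open>t0\<close>. Values of \<open>x\<close> before \<open>t0\<close> are irrelevant.\<close>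

definition din_avd_solution ::
    "real \<Rightarrow> real \<Rightarrow> real \<Rightarrow> ('a::real_inner \<Rightarrow> real) \<Rightarrow> (real \<Rightarrow> 'a) \<Rightarrow> bool"
  where "din_avd_solution \<alpha> \<beta> t0 \<Phi> x \<longleftrightarrow>
    (\<exists>x' x''.
      (\<forall>t\<ge>t0. (x has_vector_derivative x' t) (at t within {t0..})) \<and>
      (\<forall>t\<ge>t0. (x' has_vector_derivative x'' t) (at t within {t0..})) \<and>
      continuous_on {t0..} x'' \<and>
      (\<forall>t\<ge>t0. x'' t + (\<alpha> / t) *\<^sub>R x' t + \<beta> *\<^sub>R hessian \<Phi> (x t) (x' t) + gradient \<Phi> (x t) = 0))"

end

theory Submission
  imports Defs
begin

text \<open>Write \<open>G t\<close> for the gradient along the trajectory; since the Hessian term is its time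
  derivative, \<open>t (x' + \<beta> G)\<close> has derivative \<open>(1 - \<alpha>) x' + (\<beta> - t) G\<close>. For a minimiser \<open>z\<close> and every
  \<open>l\<close> strictly between \<open>2\<close> and \<open>\<alpha> - 1\<close>, the energy \<open>E\<^sub>l\<close> built from the value gap,
  \<open>l (x - z) + t (x' + \<beta> G)\<close> and \<open>x - z\<close> eventually satisfies \<open>E\<^sub>l' \<le> - \<langle>x - z, G\<rangle>\<close>. Hence \<open>E\<^sub>l\<close>
  converges, \<open>\<langle>x - z, G\<rangle>\<close> has a convergent integral \<open>W\<close>, and the value gap is \<open>O(1/t\<^sup>2)\<close>.
  The difference of the energies for two values of \<open>l\<close> shows that \<open>t q' + (\<alpha> - 1) q\<close> converges for
  \<open>q = \<parallel>x - z\<parallel>\<^sup>2 / 2 + \<beta> W\<close>; therefore so do \<open>q\<close> and \<open>\<parallel>x - z\<parallel>\<close>. Inf-compactness provides a strong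
  cluster point of \<open>x\<close>, which is a minimiser, and the distance to it must tend to \<open>0\<close>.\<close>

section \<open>Riesz representation and gradients in a Hilbert space\<close>

text \<open>The representing vector minimises \<open>\<parallel>u\<parallel>\<^sup>2 / 2 - f u\<close>; minimising sequences are Cauchy by the
  parallelogram law.\<close>

lemma riesz_representation:
  fixes f :: "'a::{real_inner, complete_space} \<Rightarrow> real"
  assumes "bounded_linear f"
  obtains y where "\<And>u. f u = y \<bullet> u"
proof -
  interpret f: bounded_linear f by fact
  define J where "J u = (norm u)\<^sup>2 / 2 - f u" for u
  obtain K where K: "\<And>u. norm (f u) \<le> norm u * K"
    using f.bounded by blast
  have "- (K\<^sup>2 / 2) \<le> J u" for u
  proof -
    have "f u \<le> norm u * K" using K[of u] by simp
    moreover have "0 \<le> (norm u - K)\<^sup>2" by simp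
    ultimately show ?thesis by (simp add: J_def power2_diff)
  qed
  then have bdd: "bdd_below (range J)" by (rule bdd_belowI2)
  define m where "m = Inf (range J)"
  have m_le: "m \<le> J u" for u
    unfolding m_def by (rule cInf_lower) (use bdd in auto)
  have "\<exists>u. J u < m + 1 / real (Suc n)" for n
    using cInf_lessD[of "range J" "m + 1 / real (Suc n)"] by (auto simp: m_def)
  then obtain w where w: "\<And>n. J (w n) < m + 1 / real (Suc n)" by metis
  \<comment> \<open>The linear part of \<open>J\<close> cancels here; since \<open>m\<close> bounds
    the midpoint value from below, two near-minimisers are close.\<close>
  have mid: "(norm (u - v))\<^sup>2 = 4 * J u + 4 * J v - 8 * J ((1/2) *\<^sub>R (u + v))" for u v
    by (simp add: J_def f.add f.scaleR power2_norm_eq_inner inner_simps inner_commute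
        algebra_simps)
  have close: "(norm (w i - w j))\<^sup>2 \<le> 4 / real (Suc i) + 4 / real (Suc j)" for i j
    using mid[of "w i" "w j"] w[of i] w[of j] m_le[of "(1/2) *\<^sub>R (w i + w j)"] by simp
  have "Cauchy w"
  proof (rule metric_CauchyI)
    fix e :: real assume e: "0 < e"
    obtain N :: nat where N: "8 / e\<^sup>2 < real N" using reals_Archimedean2 by blast
    have *: "4 / real (Suc i) < e\<^sup>2 / 2" if "i \<ge> N" for i
    proof -
      have "8 / e\<^sup>2 < real (Suc i)" using N that by simp
      then show ?thesis using e by (simp add: field_simps)
    qed
    have "dist (w i) (w j) < e" if "i \<ge> N" "j \<ge> N" for i j
    proof -
      have "(norm (w i - w j))\<^sup>2 < e\<^sup>2" using close[of i j] *[OF that(1)] *[OF that(2)] by linarith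
      then show ?thesis using e by (simp add: dist_norm power_less_imp_less_base)
    qed
    then show "\<exists>M. \<forall>m\<ge>M. \<forall>n\<ge>M. dist (w m) (w n) < e" by blast
  qed
  then obtain y where y: "w \<longlonglongrightarrow> y" using Cauchy_convergent convergent_def by blast
  have "(\<lambda>n. J (w n)) \<longlonglongrightarrow> J y"
    unfolding J_def by (intro tendsto_intros f.tendsto y) simp
  moreover have "(\<lambda>n. m + 1 / real (Suc n)) \<longlonglongrightarrow> m + 0"
    by (intro tendsto_intros LIMSEQ_Suc[OF lim_1_over_n])
  ultimately have "J y \<le> m"
    using LIMSEQ_le[of "\<lambda>n. J (w n)" "J y" "\<lambda>n. m + 1 / real (Suc n)" "m + 0"] w
    by (force intro: less_imp_le)
  then have min: "J y \<le> J u" for u using m_le[of u] by simp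
  have "f u = y \<bullet> u" for u
  proof -
    define D where "D = y \<bullet> u - f u"
    \<comment> \<open>Minimality of \<open>y\<close> along the line in direction \<open>u\<close>; a
      quadratic in \<open>s\<close> that stays nonnegative and vanishes at \<open>0\<close> has no
      linear term.\<close>
    have quad: "0 \<le> s * D + s\<^sup>2 * (u \<bullet> u) / 2" for s
    proof -
      have "J (y + s *\<^sub>R u) - J y = s * D + s\<^sup>2 * (u \<bullet> u) / 2"
        unfolding J_def D_def power2_norm_eq_inner f.add f.scaleR
        by (simp add: inner_simps inner_commute algebra_simps power2_eq_square)
      then show ?thesis using min[of "y + s *\<^sub>R u"] by simp
    qed
    \<comment> \<open>The step \<open>s = - c * D\<close> makes the quadratic term at most half the
      linear one; the summand \<open>1\<close> covers \<open>u = 0\<close>.\<close>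
    define c where "c = 1 / (1 + u \<bullet> u)"
    have c: "0 < c" "c * (u \<bullet> u) \<le> 1" by (auto simp: c_def add_pos_nonneg field_simps)
    have "D\<^sup>2 * c * (c * (u \<bullet> u)) \<le> D\<^sup>2 * c * 1" using c by (intro mult_left_mono) auto
    moreover have "(c * D)\<^sup>2 * (u \<bullet> u) = D\<^sup>2 * c * (c * (u \<bullet> u))" by (simp add: power2_eq_square)
    ultimately have "D\<^sup>2 * c \<le> 0" using quad[of "- c * D"] by (simp add: power2_eq_square algebra_simps)
    then have "D\<^sup>2 \<le> 0" using c by (simp add: mult_le_0_iff)
    then show ?thesis by (simp add: D_def)
  qed
  then show ?thesis by (rule that)
qed

lemma gradient_eqI:
  assumes "GDERIV f u :> g"
  shows "gradient f u = g"
  unfolding gradient_def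
proof (rule the_equality)
  fix g' assume "GDERIV f u :> g'"
  then have "(\<lambda>h. h \<bullet> g') = (\<lambda>h. h \<bullet> g)"
    using assms unfolding gderiv_def by (rule has_derivative_unique)
  then have "(g' - g) \<bullet> g' = (g' - g) \<bullet> g" by (rule fun_cong)
  then show "g' = g" by (metis inner_diff_right inner_eq_zero_iff right_minus_eq)
qed fact

text \<open>The Riesz map \<open>R\<close> is bounded and linear on the dual, so the gradient is
  \<open>R\<close> composed with the first derivative and inherits differentiability from it. This
  makes the descriptions in \<open>gradient\<close> and \<open>hessian\<close> denote genuine
  derivatives.\<close>

lemma
  fixes f :: "'a::{real_inner, complete_space} \<Rightarrow> real"
  assumes "twice_continuously_differentiable f"
  shows GDERIV_gradient: "GDERIV f u :> gradient f u"
    and has_derivative_hessian: "(gradient f has_derivative hessian f u) (at u)"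
proof -
  obtain f' f'' where f': "\<And>u. (f has_derivative blinfun_apply (f' u)) (at u)"
    and f'': "\<And>u. (f' has_derivative blinfun_apply (f'' u)) (at u)"
    using assms unfolding twice_continuously_differentiable_def by blast
  have "\<forall>\<phi> :: 'a \<Rightarrow>\<^sub>L real. \<exists>y. \<forall>u. blinfun_apply \<phi> u = y \<bullet> u"
    using riesz_representation[OF blinfun.bounded_linear_right] by metis
  then obtain R :: "('a \<Rightarrow>\<^sub>L real) \<Rightarrow> 'a"
    where R: "\<And>\<phi> u. blinfun_apply \<phi> u = R \<phi> \<bullet> u" by metis
  have "bounded_linear R"
  proof (rule bounded_linear_intro)
    show "R (\<phi> + \<psi>) = R \<phi> + R \<psi>" for \<phi> \<psi>
      by (rule vector_eq_rdot[THEN iffD1])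
        (simp add: inner_add_left R[symmetric] blinfun.add_left)
    show "R (r *\<^sub>R \<phi>) = r *\<^sub>R R \<phi>" for r \<phi>
      by (rule vector_eq_rdot[THEN iffD1]) (simp add: R[symmetric] blinfun.scaleR_left)
    show "norm (R \<phi>) \<le> norm \<phi> * 1" for \<phi>
    proof (cases "R \<phi> = 0")
      case False
      have "norm (R \<phi>) * norm (R \<phi>) = blinfun_apply \<phi> (R \<phi>)" 
        by (simp add: R power2_norm_eq_inner flip: power2_eq_square)
      also have "\<dots> \<le> norm \<phi> * norm (R \<phi>)" using norm_blinfun[of \<phi> "R \<phi>"] by simp
      finally show ?thesis using False by simp
    qed simp
  qed
  have G: "GDERIV f u :> R (f' u)" for u
  proof -
    have "blinfun_apply (f' u) = (\<lambda>h. h \<bullet> R (f' u))" by (simp add: fun_eq_iff R inner_commute)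
    then show ?thesis using f'[of u] by (simp add: gderiv_def)
  qed
  then have eq: "gradient f = (\<lambda>u. R (f' u))" by (auto intro: gradient_eqI)
  show "GDERIV f u :> gradient f u" using G by (simp add: eq)
  have "((\<lambda>u. R (f' u)) has_derivative (\<lambda>h. R (f'' u h))) (at u)"
    using bounded_linear.has_derivative[OF \<open>bounded_linear R\<close> f''] .
  then show "(gradient f has_derivative hessian f u) (at u)"
    unfolding hessian_def eq frechet_derivative_works[symmetric] by (rule differentiableI)
qed

text \<open>Restrict \<open>f\<close> to the line through \<open>u\<close> and \<open>z\<close>: the
  tangent at parameter \<open>0\<close> lies below the convex function at parameter
  \<open>1\<close>.\<close>

lemma convex_on_GDERIV_le:
  assumes "convex_on UNIV f" and "GDERIV f u :> g"
  shows "f u - f z \<le> (u - z) \<bullet> g"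
proof -
  let ?l = "\<lambda>s::real. u + s *\<^sub>R (z - u)"
  have conv: "convex_on UNIV (\<lambda>s. f (?l s))"
  proof (rule convex_onI)
    fix r a b :: real assume r: "0 < r" "r < 1"
    have "?l ((1 - r) *\<^sub>R a + r *\<^sub>R b) = (1 - r) *\<^sub>R ?l a + r *\<^sub>R ?l b"
      by (simp add: algebra_simps)
    then show "f (?l ((1 - r) *\<^sub>R a + r *\<^sub>R b)) \<le> (1 - r) * f (?l a) + r * f (?l b)"
      using convex_onD[OF assms(1), of r "?l a" "?l b"] r by simp
  qed simp
  have "(f has_derivative (\<lambda>h. h \<bullet> g)) (at (?l 0))"
    using assms(2) by (simp add: gderiv_def)
  moreover have "(?l has_derivative (\<lambda>s. s *\<^sub>R (z - u))) (at 0)"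
    by (auto intro!: derivative_eq_intros)
  ultimately have "((\<lambda>s. f (?l s)) has_derivative (\<lambda>s. (s *\<^sub>R (z - u)) \<bullet> g)) (at 0)"
    by (rule has_derivative_compose[rotated])
  then have "((\<lambda>s. f (?l s)) has_field_derivative ((z - u) \<bullet> g)) (at 0)"
    by (simp add: has_field_derivative_def mult.commute[of _ "(z - u) \<bullet> g"] mult_commute_abs)
  from convex_on_imp_above_tangent[OF conv _ _ _ this, of 1]
  show ?thesis by (simp add: inner_diff_left)
qed

section \<open>Limits at infinity of real functions\<close>

text \<open>L'Hopital's rule for the quotient of \<open>t powr a * q t\<close> and \<open>t powr a\<close>.\<close>

lemma tendsto_of_euler_operator:
  fixes q q' :: "real \<Rightarrow> real"
  assumes a: "a > 0"
    and q: "\<And>t. t > T \<Longrightarrow> (q has_real_derivative q' t) (at t)"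
    and lim: "((\<lambda>t. t * q' t + a * q t) \<longlongrightarrow> L) at_top"
  shows "(q \<longlongrightarrow> L / a) at_top"
proof -
  have ev: "eventually (\<lambda>t. t > max T 0) at_top" by (rule eventually_gt_at_top)
  have "((\<lambda>t. (t powr a * q t) / (t powr a)) \<longlongrightarrow> L / a) at_top"
  \<comment> \<open>This version asks only that the denominator tend to infinity, so no growth
    information on \<open>q\<close> is required.\<close>
  proof (rule lhospital_at_top_at_top[where f' = "\<lambda>t. t powr a * q' t + a * t powr (a - 1) * q t"
        and g' = "\<lambda>t. a * t powr (a - 1)"])
    have "filterlim (\<lambda>t. exp (a * ln t)) at_top at_top"
      by (intro filterlim_compose[OF exp_at_top]
          filterlim_tendsto_pos_mult_at_top[OF tendsto_const a ln_at_top])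
    moreover have "\<forall>\<^sub>F t in at_top. exp (a * ln t) = t powr a"
      using ev by eventually_elim (simp add: powr_def)
    ultimately show "filterlim (\<lambda>t. t powr a) at_top at_top"
      by (simp add: filterlim_cong)
    show "\<forall>\<^sub>F t in at_top. a * t powr (a - 1) \<noteq> 0"
      using ev by eventually_elim (use a in auto)
    show "\<forall>\<^sub>F t in at_top. ((\<lambda>t. t powr a * q t) has_real_derivative
        t powr a * q' t + a * t powr (a - 1) * q t) (at t)"
      using ev by eventually_elim (auto intro!: derivative_eq_intros q)
    show "\<forall>\<^sub>F t in at_top. ((\<lambda>t. t powr a) has_real_derivative a * t powr (a - 1)) (at t)"
      using ev by eventually_elim (auto intro!: derivative_eq_intros)
    have "((\<lambda>t. (t * q' t + a * q t) / a) \<longlongrightarrow> L / a) at_top"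
      using a by (intro tendsto_intros lim) auto
    moreover have "\<forall>\<^sub>F t in at_top. (t * q' t + a * q t) / a =
        (t powr a * q' t + a * t powr (a - 1) * q t) / (a * t powr (a - 1))"
      using ev
    proof eventually_elim
      case (elim t)
      then have "t powr a = t * t powr (a - 1)" by (simp add: powr_diff)
      then show ?case using a elim by (simp add: field_simps)
    qed
    ultimately show "((\<lambda>t. (t powr a * q' t + a * t powr (a - 1) * q t) /
        (a * t powr (a - 1))) \<longlongrightarrow> L / a) at_top"
      by (rule Lim_transform_eventually)
  qed
  moreover have "\<forall>\<^sub>F t in at_top. (t powr a * q t) / (t powr a) = q t"
    using ev by eventually_elim auto
  ultimately show ?thesis by (rule Lim_transform_eventually)
qed

lemma antimono_bdd_below_tendsto_at_top:
  fixes f :: "real \<Rightarrow> real"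
  assumes anti: "\<And>s t. T \<le> s \<Longrightarrow> s \<le> t \<Longrightarrow> f t \<le> f s"
    and low: "\<And>t. T \<le> t \<Longrightarrow> B \<le> f t"
  obtains L where "(f \<longlongrightarrow> L) at_top"
proof -
  define L where "L = Inf (f ` {T..})"
  have bdd: "bdd_below (f ` {T..})" by (rule bdd_belowI2) (use low in auto)
  have "(f \<longlongrightarrow> L) at_top"
  proof (rule decreasing_tendsto)
    show "\<forall>\<^sub>F t in at_top. L \<le> f t"
      using eventually_ge_at_top[of T]
      by eventually_elim (auto simp: L_def intro!: cInf_lower bdd)
  next
    fix c assume "L < c"
    then obtain s where s: "T \<le> s" "f s < c"
      using cInf_lessD[of "f ` {T..}" c] by (auto simp: L_def)
    show "\<forall>\<^sub>F t in at_top. f t < c"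
      using eventually_ge_at_top[of s] by eventually_elim (use anti s in force)
  qed
  then show ?thesis by (rule that)
qed

lemma has_real_derivative_inner:
  assumes "(f has_vector_derivative f') (at t)" and "(g has_vector_derivative g') (at t)"
  shows "((\<lambda>t. f t \<bullet> g t) has_real_derivative f t \<bullet> g' + f' \<bullet> g t) (at t)"
  using bounded_bilinear.has_vector_derivative[OF bounded_bilinear_inner assms]
  by (simp add: has_real_derivative_iff_has_vector_derivative)

section \<open>The trajectory and its family of energies\<close>

locale din_avd_trajectory =
  fixes \<Phi> :: "'a::{real_inner, complete_space} \<Rightarrow> real"
    and \<alpha> \<beta> t0 :: real
    and x x' x'' :: "real \<Rightarrow> 'a"
  assumes alpha: "\<alpha> > 3" and beta: "\<beta> > 0" and t0: "t0 > 0"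
    and C2: "twice_continuously_differentiable \<Phi>"
    and convex: "convex_on UNIV \<Phi>"
    and x: "\<And>t. t \<ge> t0 \<Longrightarrow> (x has_vector_derivative x' t) (at t within {t0..})"
    and x': "\<And>t. t \<ge> t0 \<Longrightarrow> (x' has_vector_derivative x'' t) (at t within {t0..})"
    and ode: "\<And>t. t \<ge> t0 \<Longrightarrow>
      x'' t + (\<alpha> / t) *\<^sub>R x' t + \<beta> *\<^sub>R hessian \<Phi> (x t) (x' t) + gradient \<Phi> (x t) = 0"
begin

abbreviation G :: "real \<Rightarrow> 'a" where "G t \<equiv> gradient \<Phi> (x t)"

lemma at_within_half_line: "t > t0 \<Longrightarrow> at t within {t0..} = at t"
  by (rule at_within_interior) simp

lemma x_deriv: "t > t0 \<Longrightarrow> (x has_vector_derivative x' t) (at t)"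
  using x[of t] by (simp add: at_within_half_line)

lemma x'_deriv: "t > t0 \<Longrightarrow> (x' has_vector_derivative x'' t) (at t)"
  using x'[of t] by (simp add: at_within_half_line)

lemma G_deriv: "t > t0 \<Longrightarrow> (G has_vector_derivative hessian \<Phi> (x t) (x' t)) (at t)"
  using vector_derivative_diff_chain_within[OF x_deriv[of t], of "gradient \<Phi>"]
    has_derivative_at_withinI[OF has_derivative_hessian[OF C2]]
  by (simp add: o_def)

lemma \<Phi>_deriv: "t > t0 \<Longrightarrow> ((\<lambda>t. \<Phi> (x t)) has_real_derivative G t \<bullet> x' t) (at t)"
  using vector_derivative_diff_chain_within[OF x_deriv[of t], of \<Phi> "\<lambda>h. h \<bullet> G t"]
    has_derivative_at_withinI[OF GDERIV_gradient[OF C2, unfolded gderiv_def]]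
  by (simp add: o_def has_real_derivative_iff_has_vector_derivative inner_commute)

lemma damped_velocity_deriv:
  assumes "t > t0"
  shows "((\<lambda>t. t *\<^sub>R (x' t + \<beta> *\<^sub>R G t)) has_vector_derivative
    (1 - \<alpha>) *\<^sub>R x' t + (\<beta> - t) *\<^sub>R G t) (at t)"
proof -
  have "x'' t + \<beta> *\<^sub>R hessian \<Phi> (x t) (x' t) = - (\<alpha> / t) *\<^sub>R x' t - G t"
    using ode[of t] assms by (simp add: algebra_simps eq_neg_iff_add_eq_0)
  then have "t *\<^sub>R (x'' t + \<beta> *\<^sub>R hessian \<Phi> (x t) (x' t)) = - \<alpha> *\<^sub>R x' t - t *\<^sub>R G t"
    using assms t0 by (simp add: scaleR_diff_right)
  then have eq: "t *\<^sub>R (x'' t + \<beta> *\<^sub>R hessian \<Phi> (x t) (x' t)) + 1 *\<^sub>R (x' t + \<beta> *\<^sub>R G t) =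
      (1 - \<alpha>) *\<^sub>R x' t + (\<beta> - t) *\<^sub>R G t"
    by (simp add: algebra_simps)
  have "((\<lambda>t. x' t + \<beta> *\<^sub>R G t) has_vector_derivative
      x'' t + \<beta> *\<^sub>R hessian \<Phi> (x t) (x' t)) (at t)"
    using has_vector_derivative_add[OF x'_deriv[OF assms]
        bounded_linear.has_vector_derivative[OF bounded_linear_scaleR_right G_deriv[OF assms]]] .
  from has_vector_derivative_scaleR[OF DERIV_ident this]
  show ?thesis by (simp only: eq)
qed

text \<open>The weight of the value gap is chosen to cancel the products
  \<open>G t \<bullet> x' t\<close> in the derivative, and the coefficient of the squared distance
  to cancel \<open>(x t - z) \<bullet> x' t\<close>.\<close>

definition energy :: "'a \<Rightarrow> real \<Rightarrow> real \<Rightarrow> real" where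
  "energy z l t = (t\<^sup>2 + t * \<beta> * (\<alpha> - l - 2)) * (\<Phi> (x t) - \<Phi> z)
    + (norm (l *\<^sub>R (x t - z) + t *\<^sub>R (x' t + \<beta> *\<^sub>R G t)))\<^sup>2 / 2
    + l * (\<alpha> - l - 1) / 2 * (norm (x t - z))\<^sup>2"

lemma energy_deriv:
  assumes "t > t0"
  shows "(energy z l has_real_derivative
      (2 * t + \<beta> * (\<alpha> - l - 2)) * (\<Phi> (x t) - \<Phi> z) - l * (t - \<beta>) * ((x t - z) \<bullet> G t)
      - t * (\<alpha> - l - 1) * (norm (x' t))\<^sup>2 - t * \<beta> * (t - \<beta>) * (norm (G t))\<^sup>2) (at t)"
proof -
  have y: "((\<lambda>t. x t - z) has_vector_derivative x' t) (at t)"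
    using assms by (auto intro!: derivative_eq_intros x_deriv)
  let ?v = "\<lambda>t. l *\<^sub>R (x t - z) + t *\<^sub>R (x' t + \<beta> *\<^sub>R G t)"
  let ?v' = "l *\<^sub>R x' t + ((1 - \<alpha>) *\<^sub>R x' t + (\<beta> - t) *\<^sub>R G t)"
  have v: "(?v has_vector_derivative ?v') (at t)"
    by (intro has_vector_derivative_add damped_velocity_deriv assms
        bounded_linear.has_vector_derivative[OF bounded_linear_scaleR_right] y)
  have weight: "((\<lambda>t. t\<^sup>2 + t * \<beta> * (\<alpha> - l - 2)) has_real_derivative
      2 * t + \<beta> * (\<alpha> - l - 2)) (at t)"
    by (auto intro!: derivative_eq_intros)
  \<comment> \<open>Expanding over abstract vectors leaves only scalar products, so the final
    cancellation is a polynomial identity.\<close>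
  have pairing: "(l *\<^sub>R a + t *\<^sub>R (p + \<beta> *\<^sub>R g)) \<bullet> (l *\<^sub>R p + ((1 - \<alpha>) *\<^sub>R p + (\<beta> - t) *\<^sub>R g)) =
      (l + 1 - \<alpha>) * (l * (a \<bullet> p) + t * (p \<bullet> p) + t * \<beta> * (g \<bullet> p))
      + (\<beta> - t) * (l * (a \<bullet> g) + t * (g \<bullet> p) + t * \<beta> * (g \<bullet> g))" for a p g :: 'a
    by (simp add: inner_simps inner_commute algebra_simps)
  show ?thesis
    unfolding energy_def[abs_def] power2_norm_eq_inner
    by (rule DERIV_cong[OF DERIV_add[OF DERIV_add[OF
          DERIV_mult[OF weight DERIV_diff[OF \<Phi>_deriv[OF assms] DERIV_const]]
          DERIV_cdivide[OF has_real_derivative_inner[OF v v]]]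
          DERIV_cmult[OF has_real_derivative_inner[OF y y]]]],
        simp only: inner_commute[of ?v'] inner_commute[of "x' t" "x t - z"] pairing, algebra)
qed

lemma convex_gap_le: "\<Phi> (x t) - \<Phi> z \<le> (x t - z) \<bullet> G t"
  using convex GDERIV_gradient[OF C2] by (rule convex_on_GDERIV_le)

definition dissipation :: "'a \<Rightarrow> real \<Rightarrow> real" where
  "dissipation z t = integral {t0..t} (\<lambda>s. (x s - z) \<bullet> G s)"

lemma continuous_on_x: "continuous_on {t0..} x"
  using x by (auto simp: continuous_on_eq_continuous_within
      intro: has_vector_derivative_continuous)

lemma continuous_on_pairing: "continuous_on {t0..} (\<lambda>s. (x s - z) \<bullet> G s)"
proof -
  have "continuous_on UNIV (gradient \<Phi>)"
    using has_derivative_continuous[OF has_derivative_hessian[OF C2]]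
    by (simp add: continuous_on_eq_continuous_at)
  then have "continuous_on {t0..} G"
    using continuous_on_compose2 continuous_on_x by blast
  then show ?thesis by (intro continuous_intros continuous_on_x)
qed

lemma dissipation_deriv:
  assumes "t > t0"
  shows "(dissipation z has_real_derivative (x t - z) \<bullet> G t) (at t)"
proof -
  \<comment> \<open>The interval reaches past \<open>t\<close>, which makes \<open>t\<close> an
    interior point and the derivative two-sided.\<close>
  have "(dissipation z has_real_derivative (x t - z) \<bullet> G t) (at t within {t0..t + 1})"
    unfolding dissipation_def[abs_def] using assms
    by (intro integral_has_real_derivative continuous_on_subset[OF continuous_on_pairing]) auto
  moreover have "at t within {t0..t + 1} = at t"
    using assms by (intro at_within_interior) simp
  ultimately show ?thesis by simp
qed

section \<open>Energy decay and value decay for a fixed minimiser\<close>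

context
  fixes z
  assumes z: "z \<in> argmin \<Phi>"
begin

lemma argmin_le: "\<Phi> z \<le> \<Phi> u"
  using z by (auto simp: argmin_def is_arg_min_def not_less)

lemma pairing_nonneg: "0 \<le> (x t - z) \<bullet> G t"
  using convex_gap_le[of t z] argmin_le[of "x t"] by simp

lemma dissipation_nonneg: "0 \<le> dissipation z t"
  unfolding dissipation_def
  by (intro integral_nonneg integrable_continuous_real
      continuous_on_subset[OF continuous_on_pairing] pairing_nonneg) auto

text \<open>The factor \<open>\<alpha> - l - 2\<close> exceeds \<open>-1\<close>, so the negative
  contribution is at most \<open>\<beta>\<close>, which \<open>t\<close> absorbs.\<close>

lemma weight_nonneg:
  assumes "l < \<alpha> - 1" and "t \<ge> \<beta>"
  shows "0 \<le> t + \<beta> * (\<alpha> - l - 2)"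
proof -
  have "\<beta> * (- 1) \<le> \<beta> * (\<alpha> - l - 2)" using assms beta by (intro mult_left_mono) auto
  then show ?thesis using assms by simp
qed

text \<open>All three summands of the energy are nonnegative; the second bound keeps only the value
  gap.\<close>

lemma energy_bounds:
  assumes l: "2 < l" "l < \<alpha> - 1" and t: "t \<ge> \<beta>"
  shows "0 \<le> energy z l t"
    and "(t + \<beta> * (\<alpha> - l - 2)) * (t * (\<Phi> (x t) - \<Phi> z)) \<le> energy z l t"
proof -
  have "0 \<le> (t + \<beta> * (\<alpha> - l - 2)) * (t * (\<Phi> (x t) - \<Phi> z))"
    using weight_nonneg[OF l(2) t] t beta argmin_le[of "x t"] by simp
  moreover have "(t + \<beta> * (\<alpha> - l - 2)) * (t * (\<Phi> (x t) - \<Phi> z)) =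
      (t\<^sup>2 + t * \<beta> * (\<alpha> - l - 2)) * (\<Phi> (x t) - \<Phi> z)"
    by (simp add: algebra_simps power2_eq_square)
  moreover have "0 \<le> l * (\<alpha> - l - 1) / 2 * (norm (x t - z))\<^sup>2" using l by simp
  moreover have "0 \<le> (norm (l *\<^sub>R (x t - z) + t *\<^sub>R (x' t + \<beta> *\<^sub>R G t)))\<^sup>2 / 2" by simp
  ultimately show "0 \<le> energy z l t"
    and "(t + \<beta> * (\<alpha> - l - 2)) * (t * (\<Phi> (x t) - \<Phi> z)) \<le> energy z l t"
    unfolding energy_def by linarith+
qed

text \<open>Convexity replaces the value gap in \<open>energy_deriv\<close> by the pairing
  \<open>w\<close>, whose total coefficient becomes negative for large times because
  \<open>l > 2\<close>; the kinetic and gradient terms already have the right sign.\<close>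

lemma energy_dissipation_antimono:
  assumes l: "2 < l" "l < \<alpha> - 1"
    and T: "T > t0" "T \<ge> \<beta>" "T \<ge> (1 + \<beta> * (\<alpha> - 2)) / (l - 2)"
    and st: "T \<le> s" "s \<le> t"
  shows "energy z l t + dissipation z t \<le> energy z l s + dissipation z s"
proof (rule DERIV_nonpos_imp_nonincreasing[OF st(2)])
  fix r assume r: "s \<le> r" "r \<le> t"
  define w where "w = (x r - z) \<bullet> G r"
  have w: "\<Phi> (x r) - \<Phi> z \<le> w" "0 \<le> w"
    using convex_gap_le pairing_nonneg by (auto simp: w_def)
  \<comment> \<open>The third bound on \<open>T\<close> is exactly what makes the coefficient of
    \<open>w\<close> nonpositive; its summand \<open>1\<close> pays for the derivative of
    \<open>dissipation\<close>.\<close>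
  have "1 + \<beta> * (\<alpha> - 2) \<le> (l - 2) * T" using T(3) l by (simp add: field_simps)
  also have "\<dots> \<le> (l - 2) * r" using l st r by simp
  finally have "2 * r + \<beta> * (\<alpha> - l - 2) - l * (r - \<beta>) + 1 \<le> 0" by (simp add: algebra_simps)
  then have "(2 * r + \<beta> * (\<alpha> - l - 2) - l * (r - \<beta>) + 1) * w \<le> 0"
    using w by (intro mult_nonpos_nonneg)
  moreover have "(2 * r + \<beta> * (\<alpha> - l - 2)) * (\<Phi> (x r) - \<Phi> z) \<le> (2 * r + \<beta> * (\<alpha> - l - 2)) * w"
    using weight_nonneg[OF l(2), of r] T t0 st r w by (intro mult_left_mono) auto
  moreover have "0 \<le> r * (\<alpha> - l - 1) * (norm (x' r))\<^sup>2" "0 \<le> r * \<beta> * (r - \<beta>) * (norm (G r))\<^sup>2"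
    using l T st r t0 beta by auto
  ultimately have "(2 * r + \<beta> * (\<alpha> - l - 2)) * (\<Phi> (x r) - \<Phi> z) - l * (r - \<beta>) * w
      - r * (\<alpha> - l - 1) * (norm (x' r))\<^sup>2 - r * \<beta> * (r - \<beta>) * (norm (G r))\<^sup>2 + w \<le> 0"
    by (simp add: distrib_right left_diff_distrib)
  moreover have "r > t0" using T st r by simp
  ultimately show "\<exists>y. ((\<lambda>t. energy z l t + dissipation z t) has_real_derivative y) (at r) \<and> y \<le> 0"
    unfolding w_def using DERIV_add[OF energy_deriv dissipation_deriv] by blast
qed

text \<open>The sum of energy and dissipation decreases and is nonnegative. The dissipation
  increases and stays below the value of that sum at \<open>T\<close>. Both limits exist, and
  subtracting gives that of the energy.\<close>

lemma energy_converges: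
  assumes l: "2 < l" "l < \<alpha> - 1"
  obtains L D where "(energy z l \<longlongrightarrow> L) at_top" and "(dissipation z \<longlongrightarrow> D) at_top"
proof -
  define T where "T = max (t0 + 1) (max \<beta> ((1 + \<beta> * (\<alpha> - 2)) / (l - 2)))"
  have T: "T > t0" "T \<ge> \<beta>" "T \<ge> (1 + \<beta> * (\<alpha> - 2)) / (l - 2)" by (auto simp: T_def)
  note anti = energy_dissipation_antimono[OF l T]
  obtain M where M: "((\<lambda>t. energy z l t + dissipation z t) \<longlongrightarrow> M) at_top"
    by (rule antimono_bdd_below_tendsto_at_top[of T "\<lambda>t. energy z l t + dissipation z t" 0])
      (use anti T energy_bounds(1)[OF l] dissipation_nonneg in auto)
  have "- dissipation z t \<le> - dissipation z s" if "T \<le> s" "s \<le> t" for s t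
    using that(2)
  proof (rule DERIV_nonpos_imp_nonincreasing)
    fix r assume "s \<le> r" "r \<le> t"
    then show "\<exists>y. ((\<lambda>t. - dissipation z t) has_real_derivative y) (at r) \<and> y \<le> 0"
      using DERIV_minus[OF dissipation_deriv[of r z]] pairing_nonneg[of r] T that by force
  qed
  moreover have "- (energy z l T + dissipation z T) \<le> - dissipation z t" if "T \<le> t" for t
    using anti[of T t] that energy_bounds(1)[OF l, of t] T by auto
  ultimately obtain D where "((\<lambda>t. - dissipation z t) \<longlongrightarrow> D) at_top"
    by (rule antimono_bdd_below_tendsto_at_top)
  then have D: "(dissipation z \<longlongrightarrow> - D) at_top"
    using tendsto_minus_cancel_left by fastforce
  have "(energy z l \<longlongrightarrow> M - (- D)) at_top"
    using tendsto_diff[OF M D] by simp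
  then show ?thesis using D that by blast
qed

text \<open>Divide the second bound of \<open>energy_bounds\<close> by its weight, which grows like
  \<open>t\<close>, while the energy converges. The factor \<open>t\<close> is kept because this
  product reappears in \<open>energy_difference\<close>.\<close>

lemma value_gap_tendsto: "((\<lambda>t. t * (\<Phi> (x t) - \<Phi> z)) \<longlongrightarrow> 0) at_top"
proof -
  \<comment> \<open>The midpoint of the admissible interval from \<open>2\<close> to
    \<open>\<alpha> - 1\<close>, nonempty since \<open>\<alpha> > 3\<close>.\<close>
  define l where "l = 2 + (\<alpha> - 3) / 2"
  have l: "2 < l" "l < \<alpha> - 1" using alpha by (auto simp: l_def field_simps)
  obtain L where L: "(energy z l \<longlongrightarrow> L) at_top" using energy_converges[OF l] by blast
  have inf: "filterlim (\<lambda>t. \<beta> * (\<alpha> - l - 2) + t) at_top at_top"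
    by (rule filterlim_tendsto_add_at_top[OF tendsto_const filterlim_ident])
  have lim: "((\<lambda>t. energy z l t / (\<beta> * (\<alpha> - l - 2) + t)) \<longlongrightarrow> 0) at_top"
    by (rule real_tendsto_divide_at_top[OF L inf])
  have lower: "\<forall>\<^sub>F t in at_top. 0 \<le> t * (\<Phi> (x t) - \<Phi> z)"
    using eventually_ge_at_top[of 0] by eventually_elim (simp add: argmin_le)
  have upper: "\<forall>\<^sub>F t in at_top. t * (\<Phi> (x t) - \<Phi> z) \<le> energy z l t / (\<beta> * (\<alpha> - l - 2) + t)"
    using eventually_ge_at_top[of \<beta>] filterlim_at_top_dense[THEN iffD1, OF inf, rule_format, of 0]
    by eventually_elim (use energy_bounds(2)[OF l] in \<open>auto simp: field_simps\<close>)
  show ?thesis by (rule tendsto_sandwich[OF lower upper tendsto_const lim])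
qed

lemma value_tendsto: "((\<lambda>t. \<Phi> (x t)) \<longlongrightarrow> \<Phi> z) at_top"
proof -
  have "((\<lambda>t. \<Phi> z + t * (\<Phi> (x t) - \<Phi> z) / t) \<longlongrightarrow> \<Phi> z + 0) at_top"
    by (intro tendsto_add tendsto_const
        real_tendsto_divide_at_top[OF value_gap_tendsto filterlim_ident])
  moreover have "\<forall>\<^sub>F t in at_top. \<Phi> z + t * (\<Phi> (x t) - \<Phi> z) / t = \<Phi> (x t)"
    using eventually_gt_at_top[of 0] by eventually_elim simp
  ultimately show ?thesis by (auto intro: Lim_transform_eventually)
qed

section \<open>Convergence of the distance to a minimiser\<close>

text \<open>The terms quadratic in \<open>l\<close> cancel between the squared norm and the distance
  term, so the energy is affine in \<open>l\<close> and the difference is \<open>k - l\<close> times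
  its slope.\<close>

lemma energy_difference:
  "energy z k t - energy z l t = (k - l) * (t * ((x t - z) \<bullet> x' t + \<beta> * ((x t - z) \<bullet> G t))
    + (\<alpha> - 1) / 2 * (norm (x t - z))\<^sup>2 - \<beta> * (t * (\<Phi> (x t) - \<Phi> z)))"
proof -
  have sq: "(norm (c *\<^sub>R y + v))\<^sup>2 / 2 + c * (\<alpha> - c - 1) / 2 * (norm y)\<^sup>2 =
      (norm v)\<^sup>2 / 2 + c * (y \<bullet> v + (\<alpha> - 1) / 2 * (norm y)\<^sup>2)" for c and y v :: 'a
    by (simp add: power2_norm_eq_inner inner_simps inner_commute field_simps)
  define v where "v = t *\<^sub>R (x' t + \<beta> *\<^sub>R G t)"
  have "energy z c t = (t\<^sup>2 + t * \<beta> * (\<alpha> - c - 2)) * (\<Phi> (x t) - \<Phi> z)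
      + ((norm v)\<^sup>2 / 2 + c * ((x t - z) \<bullet> v + (\<alpha> - 1) / 2 * (norm (x t - z))\<^sup>2))" for c
    unfolding sq[symmetric] by (simp add: energy_def v_def)
  moreover have "(x t - z) \<bullet> v = t * ((x t - z) \<bullet> x' t + \<beta> * ((x t - z) \<bullet> G t))"
    by (simp only: v_def inner_add_right inner_scaleR_right)
  moreover have "(t\<^sup>2 + t * \<beta> * (\<alpha> - k - 2)) * F + (N + k * P)
      - ((t\<^sup>2 + t * \<beta> * (\<alpha> - l - 2)) * F + (N + l * P)) = (k - l) * (P - \<beta> * (t * F))" for F N P
    by (simp add: algebra_simps)
  ultimately show ?thesis by (simp only:)
qed

lemma distance_converges: obtains L where "((\<lambda>t. norm (x t - z)) \<longlongrightarrow> L) at_top"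
proof -
  \<comment> \<open>The two points dividing the admissible interval into thirds.\<close>
  define l k where "l = 2 + (\<alpha> - 3) / 3" and "k = 2 + 2 * (\<alpha> - 3) / 3"
  have l: "2 < l" "l < \<alpha> - 1" and k: "2 < k" "k < \<alpha> - 1" and "k \<noteq> l"
    using alpha by (auto simp: l_def k_def field_simps)
  obtain L D where L: "(energy z l \<longlongrightarrow> L) at_top" and D: "(dissipation z \<longlongrightarrow> D) at_top"
    using energy_converges[OF l] .
  obtain K where K: "(energy z k \<longlongrightarrow> K) at_top" using energy_converges[OF k] by blast
  \<comment> \<open>The dissipation is added so that \<open>q'\<close> is precisely the bracket
    multiplied by \<open>t\<close> in \<open>energy_difference\<close>.\<close>
  define q where "q t = (x t - z) \<bullet> (x t - z) / 2 + \<beta> * dissipation z t" for t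
  define q' where "q' t = (x t - z) \<bullet> x' t + \<beta> * ((x t - z) \<bullet> G t)" for t
  have q: "(q has_real_derivative q' t) (at t)" if "t > t0" for t
  proof -
    have y: "((\<lambda>t. x t - z) has_vector_derivative x' t) (at t)"
      using that by (auto intro!: derivative_eq_intros x_deriv)
    show ?thesis
      using DERIV_add[OF DERIV_cdivide[OF has_real_derivative_inner[OF y y], of 2]
          DERIV_cmult[OF dissipation_deriv[OF that], of \<beta> z]]
      by (simp add: q_def[abs_def] q'_def inner_commute)
  qed
  \<comment> \<open>Every term on the right has a known limit: two energies, the value gap times
    \<open>t\<close>, and the dissipation.\<close>
  have "t * q' t + (\<alpha> - 1) * q t = (energy z k t - energy z l t) / (k - l)
      + \<beta> * (t * (\<Phi> (x t) - \<Phi> z)) + (\<alpha> - 1) * (\<beta> * dissipation z t)" for t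
  proof -
    have "(energy z k t - energy z l t) / (k - l) =
        t * ((x t - z) \<bullet> x' t + \<beta> * ((x t - z) \<bullet> G t))
        + (\<alpha> - 1) / 2 * (norm (x t - z))\<^sup>2 - \<beta> * (t * (\<Phi> (x t) - \<Phi> z))"
      using \<open>k \<noteq> l\<close> by (simp add: energy_difference)
    moreover have "X + (\<alpha> - 1) * (n / 2 + d) = X + (\<alpha> - 1) / 2 * n - C + C + (\<alpha> - 1) * d" for X n C d
      by (simp add: field_simps)
    ultimately show ?thesis unfolding q_def q'_def power2_norm_eq_inner by (simp only:)
  qed
  moreover have "((\<lambda>t. (energy z k t - energy z l t) / (k - l) + \<beta> * (t * (\<Phi> (x t) - \<Phi> z))
      + (\<alpha> - 1) * (\<beta> * dissipation z t)) \<longlongrightarrow>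
      (K - L) / (k - l) + \<beta> * 0 + (\<alpha> - 1) * (\<beta> * D)) at_top"
    using \<open>k \<noteq> l\<close> by (intro tendsto_intros K L D value_gap_tendsto) auto
  ultimately obtain M where "((\<lambda>t. t * q' t + (\<alpha> - 1) * q t) \<longlongrightarrow> M) at_top" by simp
  then have "(q \<longlongrightarrow> M / (\<alpha> - 1)) at_top"
    using alpha q by (intro tendsto_of_euler_operator[of "\<alpha> - 1" t0 q q']) auto
  then have "((\<lambda>t. sqrt (2 * (q t - \<beta> * dissipation z t))) \<longlongrightarrow>
      sqrt (2 * (M / (\<alpha> - 1) - \<beta> * D))) at_top"
    by (intro tendsto_intros D)
  then show ?thesis by (intro that) (simp add: q_def norm_eq_sqrt_inner)
qed

end

section \<open>Strong convergence by compactness\<close>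

lemma converges_to_argmin:
  assumes compact: "boundedly_inf_compact \<Phi>" and "argmin \<Phi> \<noteq> {}"
  shows "\<exists>z\<in>argmin \<Phi>. (x \<longlongrightarrow> z) at_top"
proof -
  obtain y where y: "y \<in> argmin \<Phi>" using assms(2) by blast
  obtain L where L: "((\<lambda>t. norm (x t - y)) \<longlongrightarrow> L) at_top" using distance_converges[OF y] .
  \<comment> \<open>The margins \<open>1\<close> above both limits let the trajectory enter
    \<open>S\<close> eventually; the absolute value keeps the radius positive without knowing the
    sign of \<open>L\<close>.\<close>
  define S where "S = closure {u. \<Phi> u \<le> \<Phi> y + 1 \<and> norm u \<le> norm y + \<bar>L\<bar> + 1}"
  have "compact S"
    using compact unfolding boundedly_inf_compact_def S_def by (simp add: add_nonneg_pos)
  have "\<forall>\<^sub>F t in at_top. norm (x t - y) < \<bar>L\<bar> + 1"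
    using order_tendstoD(2)[OF L] by simp
  moreover have "\<forall>\<^sub>F t in at_top. \<Phi> (x t) < \<Phi> y + 1"
    using order_tendstoD(2)[OF value_tendsto[OF y]] by simp
  ultimately have "\<forall>\<^sub>F t in at_top. x t \<in> S"
  proof eventually_elim
    case (elim t)
    have "norm (x t) \<le> norm y + norm (x t - y)" by (rule norm_triangle_sub)
    then show ?case using elim closure_subset by (force simp: S_def)
  qed
  then obtain N where N: "\<And>t. t \<ge> N \<Longrightarrow> x t \<in> S" by (auto simp: eventually_at_top_linorder)
  then have "\<forall>n. x (N + real n) \<in> S" by simp
  then obtain z r where r: "strict_mono (r :: nat \<Rightarrow> nat)"
    and z: "((\<lambda>n. x (N + real n)) \<circ> r) \<longlonglongrightarrow> z"
    using \<open>compact S\<close> unfolding compact_def by meson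
  define s where "s n = N + real (r n)" for n
  have s: "filterlim s at_top sequentially"
    unfolding s_def
    by (intro filterlim_tendsto_add_at_top[OF tendsto_const]
        filterlim_compose[OF filterlim_real_sequentially] filterlim_subseq r)
  have xs: "(\<lambda>n. x (s n)) \<longlonglongrightarrow> z" using z by (simp add: o_def s_def)
  have "isCont \<Phi> z"
    using GDERIV_gradient[OF C2] unfolding gderiv_def by (rule has_derivative_continuous)
  then have "(\<lambda>n. \<Phi> (x (s n))) \<longlonglongrightarrow> \<Phi> z" using xs by (rule isCont_tendsto_compose)
  moreover have "(\<lambda>n. \<Phi> (x (s n))) \<longlonglongrightarrow> \<Phi> y"
    using value_tendsto[OF y] s by (rule filterlim_compose)
  ultimately have "\<Phi> z = \<Phi> y" by (rule LIMSEQ_unique)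
  then have zmin: "z \<in> argmin \<Phi>" using y by (simp add: argmin_def is_arg_min_def)
  \<comment> \<open>The cluster point is itself a minimiser, so the distance to it converges along
    the whole trajectory; the subsequence identifies the limit as \<open>0\<close>.\<close>
  obtain M where M: "((\<lambda>t. norm (x t - z)) \<longlongrightarrow> M) at_top" using distance_converges[OF zmin] .
  have "(\<lambda>n. norm (x (s n) - z)) \<longlonglongrightarrow> M" using M s by (rule filterlim_compose)
  moreover have "(\<lambda>n. norm (x (s n) - z)) \<longlonglongrightarrow> 0"
    using xs by (simp add: tendsto_norm_zero LIM_zero)
  ultimately have "M = 0" by (rule LIMSEQ_unique)
  then have "(x \<longlongrightarrow> z) at_top" using M by (simp add: LIM_zero_cancel tendsto_norm_zero_iff)
  then show ?thesis using zmin by blast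
qed

end

theorem theorem2p3:
  fixes \<Phi> :: "'a::{real_inner, complete_space} \<Rightarrow> real"
    and \<alpha> \<beta> t0 :: real
    and x :: "real \<Rightarrow> 'a"
  assumes "\<alpha> > 3" and "\<beta> > 0" and "t0 > 0"
    and "twice_continuously_differentiable \<Phi>"
    and "convex_on UNIV \<Phi>"
    and "boundedly_inf_compact \<Phi>"
    and "argmin \<Phi> \<noteq> {}"
    and "din_avd_solution \<alpha> \<beta> t0 \<Phi> x"
  shows "\<exists>z\<in>argmin \<Phi>. (x \<longlongrightarrow> z) at_top"
proof -
  obtain x' x'' where "din_avd_trajectory \<Phi> \<alpha> \<beta> t0 x x' x''"
    using assms unfolding din_avd_solution_def din_avd_trajectory_def by blast
  then show ?thesis using assms by (intro din_avd_trajectory.converges_to_argmin)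
qed

end
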